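(* Let $P$ be a finite lattice. Both maps $\chi\colon \mathrm{Fac}(P)\to\mathrm{End}(P)$, $(L,R)\mapsto\chi^{(L,R)}$, and $\lambda\colon \mathrm{Fac}(P)\to\mathrm{End}(P)$, $(L,R)\mapsto\lambda^{(L,R)}$, are antitone: if $(L,R)\le (L',R')$ in $\mathrm{Fac}(P)$, then $\chi^{(L',R')}\le\chi^{(L,R)}$ and $\lambda^{(L',R')}\le\lambda^{(L,R)}$ in $\mathrm{End}(P)$.
   Context: A finite lattice $P$ with minimum $0$ and maximum $1$ is viewed as a category with a unique morphism $x\to y$ exactly when $x\le y$; classes of morphisms are subsets of the relation $\le$, and we write $x\,M\,y$ when the relation $x\le y$ belongs to $M$. A relation $a\le b$ has the left lifting property with respect to $x\le y$ (and $x\le y$ has the right lifting property with respect to $a\le b$) if $a\le x$ and $b\le y$ together imply $b\le x$. For a class $M$, ${}^\perp M$ is the class of relations with the left lifting property with respect to all of $M$, and $M^\perp$ is the class of relations with the right lifting property with respect to all of $M$. A factorization system on $P$ is a pair $(L,R)$ of classes of relations such that every relation $x\le z$ factors as $x\,L\,y\,R\,z$ for some $y$, and $L={}^\perp R$, $R=L^\perp$. The factoring object $y$ is then unique. $\mathrm{Fac}(P)$ is the set of factorization systems on $P$, ordered by $(L,R)\le (L',R')$ iff $R\subseteq R'$ (equivalently $L'\subseteq L$). $\mathrm{End}(P)$ is the poset of monotone maps $P\to P$ with the pointwise order. The characteristic function $\chi^{(L,R)}\in\mathrm{End}(P)$ sends $x$ to the unique object with $0\,L\,\chi^{(L,R)}(x)\,R\,x$;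 the cocharacteristic function $\lambda^{(L,R)}\in\mathrm{End}(P)$ sends $x$ to the unique object with $x\,L\,\lambda^{(L,R)}(x)\,R\,1$. *)

theory Defs
  imports Main "HOL-Library.FuncSet"
begin

text \<open>
  The lattice P is the carrier type itself. A morphism \<open>x \<rightarrow> y\<close> of P is a pair \<open>(x, y)\<close>
  with \<open>x \<le> y\<close>, and a class of morphisms is a set of such pairs.
\<close>

definition arrows :: "'a::order rel"
  where "arrows = {(x, y). x \<le> y}"

text \<open>
  \<open>lifts (a, b) (x, y)\<close>: the relation \<open>a \<le> b\<close> has the left lifting property with respect to
  \<open>x \<le> y\<close>. All diagrams in a poset commute, so a commutative square from \<open>a \<rightarrow> b\<close> to
  \<open>x \<rightarrow> y\<close> is just \<open>a \<le> x \<and> b \<le> y\<close>, and a diagonal filler is \<open>b \<le> x\<close>.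
\<close>

fun lifts :: "'a::order \<times> 'a \<Rightarrow> 'a \<times> 'a \<Rightarrow> bool"
  where "lifts (a, b) (x, y) \<longleftrightarrow> (a \<le> x \<and> b \<le> y \<longrightarrow> b \<le> x)"

definition left_perp :: "'a::order rel \<Rightarrow> 'a rel"
  where "left_perp M = {f \<in> arrows. \<forall>g\<in>M. lifts f g}"

definition right_perp :: "'a::order rel \<Rightarrow> 'a rel"
  where "right_perp M = {g \<in> arrows. \<forall>f\<in>M. lifts f g}"

definition factorization_system :: "'a::order rel \<Rightarrow> 'a rel \<Rightarrow> bool"
  where "factorization_system L R \<longleftrightarrow>
    L \<subseteq> arrows \<and> R \<subseteq> arrows \<and>
    (\<forall>x z. x \<le> z \<longrightarrow> (\<exists>y. (x, y) \<in> L \<and> (y, z) \<in> R)) \<and>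
    L = left_perp R \<and> R = right_perp L"

definition Fac :: "('a::order rel \<times> 'a rel) set"
  where "Fac = {(L, R). factorization_system L R}"

definition Fac_le :: "'a::order rel \<times> 'a rel \<Rightarrow> 'a rel \<times> 'a rel \<Rightarrow> bool"
  where "Fac_le F F' \<longleftrightarrow> snd F \<subseteq> snd F'"

text \<open>The order on \<open>End\<close> is the library's pointwise order on functions.\<close>

definition End :: "('a::order \<Rightarrow> 'a) set"
  where "End = {f. mono f}"

lemma factorization_systemD:
  assumes "factorization_system L R"
  shows "L \<subseteq> arrows" "R \<subseteq> arrows" "x \<le> z \<Longrightarrow> \<exists>y. (x, y) \<in> L \<and> (y, z) \<in> R"
    and "L = left_perp R" "R = right_perp L"
proof -
  note * = assms[unfolded factorization_system_def]
  show "L \<subseteq> arrows" by (rule *[THEN conjunct1])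
  show "R \<subseteq> arrows" by (rule *[THEN conjunct2, THEN conjunct1])
  show "\<exists>y. (x, y) \<in> L \<and> (y, z) \<in> R" if "x \<le> z"
    using *[THEN conjunct2, THEN conjunct2, THEN conjunct1] that by simp
  show "L = left_perp R"
    by (rule *[THEN conjunct2, THEN conjunct2, THEN conjunct2, THEN conjunct1])
  show "R = right_perp L"
    by (rule *[THEN conjunct2, THEN conjunct2, THEN conjunct2, THEN conjunct2])
qed

lemma factoring_object_unique:
  assumes "factorization_system L R" and "x \<le> z"
  shows "\<exists>!y. (x, y) \<in> L \<and> (y, z) \<in> R"
proof (rule ex_ex1I)
  show "\<exists>y. (x, y) \<in> L \<and> (y, z) \<in> R"
    using assms by (rule factorization_systemD)
next
  have *: "y \<le> y'" if "(x, y) \<in> L" "(y, z) \<in> R" "(x, y') \<in> L" "(y', z) \<in> R" for y y'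
  proof -
    have "x \<le> y'" "y \<le> z"
      using that factorization_systemD(1,2)[OF assms(1)] by (auto simp: arrows_def)
    moreover have "(x, y) \<in> left_perp R"
      using that(1) factorization_systemD(4)[OF assms(1)] by (rule subst[rotated])
    then have "lifts (x, y) (y', z)"
      using that(4) by (auto simp only: left_perp_def)
    ultimately show ?thesis by simp
  qed
  show "y = y'" if "(x, y) \<in> L \<and> (y, z) \<in> R" "(x, y') \<in> L \<and> (y', z) \<in> R" for y y'
    using that by (intro antisym) (simp_all add: *)
qed

text \<open>
  By \<open>factoring_object_unique\<close>, the definite descriptions below are well defined on \<open>Fac\<close>;
  outside \<open>Fac\<close> the values are unspecified.
\<close>

definition char_fun :: "'a::bounded_lattice rel \<times> 'a rel \<Rightarrow> 'a \<Rightarrow> 'a"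
  where "char_fun F x = (THE y. (bot, y) \<in> fst F \<and> (y, x) \<in> snd F)"

definition cochar_fun :: "'a::bounded_lattice rel \<times> 'a rel \<Rightarrow> 'a \<Rightarrow> 'a"
  where "cochar_fun F x = (THE y. (x, y) \<in> fst F \<and> (y, top) \<in> snd F)"

end

theory Submission
  imports Defs
begin

text \<open>
  Everything follows from a single use of orthogonality. Let \<open>(L, R) \<le> (L', R')\<close> and
  \<open>x \<le> x'\<close>. The relation of \<open>L'\<close> in the factorization of \<open>x\<close> with respect to \<open>(L', R')\<close>
  lifts against every relation of \<open>R \<subseteq> R'\<close>, in particular against the one in the factorization
  of \<open>x'\<close> with respect to \<open>(L, R)\<close>. The resulting diagonal says
  \<open>\<chi>' x \<le> \<chi> x'\<close>, and likewise \<open>\<lambda>' x \<le> \<lambda> x'\<close>. Taking \<open>F = F'\<close> in this inequality gives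
  monotonicity of each single map, and taking \<open>x = x'\<close> gives antitonicity in the
  factorization system.
\<close>

lemma left_right_lift:
  assumes "F \<in> Fac" and "(a, b) \<in> fst F" and "(x, y) \<in> snd F" and "a \<le> x" and "b \<le> y"
  shows "b \<le> x"
proof -
  have "factorization_system (fst F) (snd F)"
    using assms(1) by (auto simp: Fac_def)
  then have "(a, b) \<in> left_perp (snd F)"
    using assms(2) factorization_systemD(4) by blast
  then have "lifts (a, b) (x, y)"
    using assms(3) by (auto simp only: left_perp_def)
  then show ?thesis
    using assms(4,5) by simp
qed

lemma Fac_subset_arrows:
  assumes "F \<in> Fac"
  shows "(x, y) \<in> fst F \<Longrightarrow> x \<le> y" and "(x, y) \<in> snd F \<Longrightarrow> x \<le> y"
  using assms by (auto simp: Fac_def factorization_system_def arrows_def)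

lemma char_fun_factors:
  assumes "F \<in> Fac"
  shows "(bot, char_fun F x) \<in> fst F" and "(char_fun F x, x) \<in> snd F"
proof -
  have "\<exists>!y. (bot, y) \<in> fst F \<and> (y, x) \<in> snd F"
    using assms by (intro factoring_object_unique) (auto simp: Fac_def)
  from theI'[OF this] show "(bot, char_fun F x) \<in> fst F" "(char_fun F x, x) \<in> snd F"
    by (simp_all add: char_fun_def)
qed

lemma cochar_fun_factors:
  assumes "F \<in> Fac"
  shows "(x, cochar_fun F x) \<in> fst F" and "(cochar_fun F x, top) \<in> snd F"
proof -
  have "\<exists>!y. (x, y) \<in> fst F \<and> (y, top) \<in> snd F"
    using assms by (intro factoring_object_unique) (auto simp: Fac_def)
  from theI'[OF this] show "(x, cochar_fun F x) \<in> fst F" "(cochar_fun F x, top) \<in> snd F"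
    by (simp_all add: cochar_fun_def)
qed

text \<open>
  The square to fill goes from \<open>0 \<rightarrow> \<chi>' x\<close> to \<open>\<chi> x' \<rightarrow> x'\<close>; its top side exists because \<open>0\<close> is
  minimal, its bottom side is \<open>\<chi>' x \<le> x \<le> x'\<close>.
\<close>

lemma char_fun_le:
  assumes "F \<in> Fac" and "F' \<in> Fac" and "Fac_le F F'" and "x \<le> x'"
  shows "char_fun F' x \<le> char_fun F x'"
proof (rule left_right_lift[OF assms(2)])
  show "(bot, char_fun F' x) \<in> fst F'"
    by (rule char_fun_factors(1)[OF assms(2)])
  show "(char_fun F x', x') \<in> snd F'"
    using char_fun_factors(2)[OF assms(1)] assms(3) by (auto simp: Fac_le_def)
  have "char_fun F' x \<le> x"
    by (rule Fac_subset_arrows(2)[OF assms(2) char_fun_factors(2)[OF assms(2)]])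
  then show "char_fun F' x \<le> x'"
    using assms(4) by (rule order_trans)
qed simp

text \<open>
  Dually, the square goes from \<open>x \<rightarrow> \<lambda>' x\<close> to \<open>\<lambda> x' \<rightarrow> 1\<close>; its top side is
  \<open>x \<le> x' \<le> \<lambda> x'\<close>, its bottom side exists because \<open>1\<close> is maximal.
\<close>

lemma cochar_fun_le:
  assumes "F \<in> Fac" and "F' \<in> Fac" and "Fac_le F F'" and "x \<le> x'"
  shows "cochar_fun F' x \<le> cochar_fun F x'"
proof (rule left_right_lift[OF assms(2)])
  show "(x, cochar_fun F' x) \<in> fst F'"
    by (rule cochar_fun_factors(1)[OF assms(2)])
  show "(cochar_fun F x', top) \<in> snd F'"
    using cochar_fun_factors(2)[OF assms(1)] assms(3) by (auto simp: Fac_le_def)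
  have "x' \<le> cochar_fun F x'"
    by (rule Fac_subset_arrows(1)[OF assms(1) cochar_fun_factors(1)[OF assms(1)]])
  with assms(4) show "x \<le> cochar_fun F x'"
    by (rule order_trans)
qed simp

theorem proposition3p5:
  shows "(char_fun :: 'a::{finite, bounded_lattice} rel \<times> 'a rel \<Rightarrow> 'a \<Rightarrow> 'a) \<in> Fac \<rightarrow> End \<and>
    (cochar_fun :: 'a rel \<times> 'a rel \<Rightarrow> 'a \<Rightarrow> 'a) \<in> Fac \<rightarrow> End \<and>
    monotone_on Fac Fac_le (\<ge>) (char_fun :: 'a rel \<times> 'a rel \<Rightarrow> 'a \<Rightarrow> 'a) \<and>
    monotone_on Fac Fac_le (\<ge>) (cochar_fun :: 'a rel \<times> 'a rel \<Rightarrow> 'a \<Rightarrow> 'a)"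
proof (intro conjI)
  have Fac_le_refl: "Fac_le F F" for F :: "'a rel \<times> 'a rel"
    by (simp add: Fac_le_def)
  show "(char_fun :: 'a rel \<times> 'a rel \<Rightarrow> 'a \<Rightarrow> 'a) \<in> Fac \<rightarrow> End"
    using char_fun_le[OF _ _ Fac_le_refl] by (auto simp: End_def intro!: monoI)
  show "(cochar_fun :: 'a rel \<times> 'a rel \<Rightarrow> 'a \<Rightarrow> 'a) \<in> Fac \<rightarrow> End"
    using cochar_fun_le[OF _ _ Fac_le_refl] by (auto simp: End_def intro!: monoI)
  show "monotone_on Fac Fac_le (\<ge>) (char_fun :: 'a rel \<times> 'a rel \<Rightarrow> 'a \<Rightarrow> 'a)"
    by (intro monotone_onI le_funI char_fun_le order_refl)
  show "monotone_on Fac Fac_le (\<ge>) (cochar_fun :: 'a rel \<times> 'a rel \<Rightarrow> 'a \<Rightarrow> 'a)"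
    by (intro monotone_onI le_funI cochar_fun_le order_refl)
qed

end
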